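(* Let $H:[0,\infty)\to(1/2,1)$ be measurable and let $X^H$ be a separable fractional Brownian motion with variable Hurst parameter $H$. If $H$ has a discontinuity at some $t_0\neq0$, then $X^H$ has almost surely discontinuous sample paths. Moreover, $P(X^H\text{ is discontinuous at }t_0)>0$, and almost surely the paths of $X^H$ have either a discontinuity at $t_0$ or a sequence of discontinuity points converging to $t_0$.
   Context: $\beta(\cdot,\cdot)$ denotes the Beta function, and for $h\in(1/2,1)$ set $c_h=\left(\frac{h(2h-1)}{\beta(2-2h,\,h-1/2)}\right)^{1/2}$. For measurable $H:[0,\infty)\to(1/2,1)$ write $H_t=H(t)$ and, for $s,t\ge0$, $$K_H(t,s)=\left[c_{H_t}s^{\frac12-H_t}\int_s^t(u-s)^{H_t-\frac32}u^{H_t-\frac12}\,du\right]\mathbf 1_{[0,t]}(s),\qquad R_H(t,s)=\int_0^{s\wedge t}K_H(t,u)K_H(s,u)\,du .$$ Fractional Brownian motion with variable Hurst parameter $H$ (fBMvH) is the centered Gaussian process $X^H=(X^H_t)_{t\ge0}$ starting at zero with covariance function $R_H$. A process is separable if (in the sense of Doob) there are a countable set $D\subset[0,\infty)$ and a null event $\Lambda$ such that for every closed set $A\subseteq\mathbb{R}$ and every open interval $I$, the events $\{X_t\in A\ \forall t\in I\cap D\}$ and $\{X_t\in A\ \forall t\in I\cap[0,\infty)\}$ differ only by a subset of $\Lambda$. *)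

theory Defs
  imports "HOL-Probability.Probability"
begin

definition c_hurst :: "real \<Rightarrow> real" where
  "c_hurst h = sqrt (h * (2 * h - 1) / Beta (2 - 2 * h) (h - 1/2))"

(* The conventions 0 powr a = 0 only affect the integrands on Lebesgue null sets. *)
definition K_kernel :: "(real \<Rightarrow> real) \<Rightarrow> real \<Rightarrow> real \<Rightarrow> real" where
  "K_kernel H t s =
     c_hurst (H t) * s powr (1/2 - H t)
       * (LINT u:{s..t}|lborel. (u - s) powr (H t - 3/2) * u powr (H t - 1/2))
       * indicator {0..t} s"

definition R_cov :: "(real \<Rightarrow> real) \<Rightarrow> real \<Rightarrow> real \<Rightarrow> real" where
  "R_cov H t s = (LINT u:{0..min s t}|lborel. K_kernel H t u * K_kernel H s u)"

(* The normal law with mean m and standard deviation \<sigma> \<ge> 0; \<sigma> = 0 gives the Dirac measure. *)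
definition normal_law :: "real \<Rightarrow> real \<Rightarrow> real measure" where
  "normal_law m \<sigma> =
     (if \<sigma> = 0 then return borel m
      else density lborel (\<lambda>x. ennreal (normal_density m \<sigma> x)))"

(* Joint normality of the finite-dimensional distributions, which may be degenerate:
   every finite linear combination is normal. *)
definition gaussian_process :: "'w measure \<Rightarrow> 't set \<Rightarrow> ('t \<Rightarrow> 'w \<Rightarrow> real) \<Rightarrow> bool" where
  "gaussian_process M T X \<longleftrightarrow>
     (\<forall>t\<in>T. X t \<in> borel_measurable M) \<and>
     (\<forall>J a. finite J \<and> J \<subseteq> T \<longrightarrow>
        (\<exists>m \<sigma>. 0 \<le> \<sigma> \<and>
           distr M borel (\<lambda>\<omega>. \<Sum>t\<in>J. a t * X t \<omega>) = normal_law m \<sigma>))"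

definition covariance :: "'w measure \<Rightarrow> ('w \<Rightarrow> real) \<Rightarrow> ('w \<Rightarrow> real) \<Rightarrow> real" where
  "covariance M Y Z =
     (LINT \<omega>|M. (Y \<omega> - (LINT \<omega>'|M. Y \<omega>')) * (Z \<omega> - (LINT \<omega>'|M. Z \<omega>')))"

(* Only the values X t with t \<ge> 0 are part of the process. *)
definition fBMvH :: "'w measure \<Rightarrow> (real \<Rightarrow> real) \<Rightarrow> (real \<Rightarrow> 'w \<Rightarrow> real) \<Rightarrow> bool" where
  "fBMvH M H X \<longleftrightarrow>
     gaussian_process M {0..} X \<and>
     (\<forall>t\<ge>0. (LINT \<omega>|M. X t \<omega>) = 0) \<and>
     (AE \<omega> in M. X 0 \<omega> = 0) \<and>
     (\<forall>s\<ge>0. \<forall>t\<ge>0. covariance M (X t) (X s) = R_cov H t s)"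

(* Separability in the sense of Doob, for the class of closed sets. *)
definition separable_process :: "'w measure \<Rightarrow> (real \<Rightarrow> 'w \<Rightarrow> real) \<Rightarrow> bool" where
  "separable_process M X \<longleftrightarrow>
     (\<exists>D \<Lambda>. countable D \<and> D \<subseteq> {0..} \<and> \<Lambda> \<in> null_sets M \<and>
        (\<forall>A I. closed A \<and> open I \<and> is_interval I \<longrightarrow>
           sym_diff {\<omega> \<in> space M. \<forall>t\<in>I \<inter> D. X t \<omega> \<in> A}
                    {\<omega> \<in> space M. \<forall>t\<in>I \<inter> {0..}. X t \<omega> \<in> A} \<subseteq> \<Lambda>))"

definition discontinuous_at :: "(real \<Rightarrow> real) \<Rightarrow> real \<Rightarrow> bool" where
  "discontinuous_at f t \<longleftrightarrow> \<not> continuous (at t within {0..}) f"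

end

theory Submission
  imports Defs
begin

text \<open>
  The three claims follow from one: almost surely the path is discontinuous at \<open>t0\<close>
  itself.

  Suppose \<open>H\<close> jumps at \<open>t0 > 0\<close>: there are \<open>t n \<longlonglongrightarrow> t0\<close> with
  \<open>\<bar>H (t n) - H t0\<bar> \<ge> \<epsilon>\<close>. The increments \<open>Y n = X (t n) - X t0\<close> are
  centered normal variables, and since \<open>R_cov\<close> is a Gram matrix of the kernels, the variance of
  \<open>Y n\<close> is the squared \<open>L\<^sup>2\<close> distance between \<open>K_kernel H (t n)\<close> and
  \<open>K_kernel H t0\<close> (\<open>fBMvH_increment_variance\<close>). Two facts then finish the proof.

  \<^item> These variances stay above some \<open>\<eta> > 0\<close> (\<open>K_kernel_L2_separated\<close>). As a
    function of \<open>s\<close> near \<open>0\<close>, the kernel with Hurst index \<open>h\<close> equals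
    \<open>s powr (1/2 - h)\<close> up to a multiplicative constant and a factor in \<open>[1, 4]\<close>, where
    the range \<open>[1, 4]\<close> depends neither on \<open>h\<close> nor on \<open>t\<close>. Two power laws whose
    exponents differ by at least \<open>\<epsilon>\<close> cannot be close to each other on two windows of
    \<open>s\<close> that are far apart on the logarithmic scale, whatever their constants are. Comparing
    exponents instead of the variances \<open>R_cov H t t = t powr (2 * H t)\<close> covers the case
    \<open>t0 = 1\<close>, where the variance does not depend on the Hurst index.

  \<^item> Centered normal variables with variance at least \<open>\<eta>\<close> almost surely do not converge
    to \<open>0\<close> (\<open>AE_not_tendsto_0_of_variance_bounded_below\<close>), because they charge
    \<open>[-d, d]\<close> with mass of order \<open>d\<close> at most, uniformly in \<open>n\<close>.

  Continuity of a path at \<open>t0\<close> would force \<open>Y n \<longlonglongrightarrow> 0\<close> on that path.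
\<close>

section \<open>Power-law behaviour of the kernel\<close>

lemma integral_shifted_powr:
  fixes a s t :: real
  assumes "-1 < a" "s \<le> t"
  shows "set_integrable lborel {s..t} (\<lambda>u. (u - s) powr a)"
    and "(LINT u:{s..t}|lborel. (u - s) powr a) = (t - s) powr (a + 1) / (a + 1)"
proof -
  have "((\<lambda>x. x powr a) has_integral ((t - s) powr (a+1) / (a+1))) {0..t - s}"
    using assms by (intro has_integral_powr_from_0) auto
  then have nn: "(\<integral>\<^sup>+x. ennreal (x powr a) * indicator {0..t-s} x \<partial>lborel)
      = ennreal ((t - s) powr (a+1) / (a+1))"
    by (intro nn_integral_has_integral_lebesgue') auto
  have "has_bochner_integral lborel (\<lambda>x. indicator {0..t-s} x * x powr a) ((t - s) powr (a+1) / (a+1))"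
    using nn assms by (intro has_bochner_integral_nn_integral)
      (auto simp: ennreal_mult mult.commute ennreal_indicator)
  then have "has_bochner_integral lborel (\<lambda>x. indicator {0..t-s} (-s + 1 * x) * (-s + 1 * x) powr a)
      (((t - s) powr (a+1) / (a+1)) /\<^sub>R \<bar>1\<bar>)"
    by (subst (asm) lborel_has_bochner_integral_real_affine_iff[where c=1 and t="-s"]) auto
  also have "(\<lambda>x. indicator {0..t-s} (-s + 1 * x) * (-s + 1 * x) powr a)
      = (\<lambda>x. indicator {s..t} x *\<^sub>R (x - s) powr a)"
    by (auto simp: fun_eq_iff indicator_def)
  finally have *: "has_bochner_integral lborel (\<lambda>x. indicator {s..t} x *\<^sub>R (x - s) powr a)
      ((t - s) powr (a+1) / (a+1))" by simp
  show "set_integrable lborel {s..t} (\<lambda>u. (u - s) powr a)"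
    using * unfolding set_integrable_def by (rule integrable.intros)
  show "(LINT u:{s..t}|lborel. (u - s) powr a) = (t - s) powr (a + 1) / (a + 1)"
    using * unfolding set_lebesgue_integral_def by (rule has_bochner_integral_integral_eq)
qed

text \<open>The factor \<open>u powr (h - 1/2)\<close> is bounded above by \<open>t powr (h - 1/2)\<close>
  and below by \<open>(u - s) powr (h - 1/2)\<close>; either replacement leaves an integral of a power
  of \<open>u - s\<close>. For \<open>s\<close> well below \<open>t\<close> the two bounds differ by a bounded
  factor, uniformly in \<open>h\<close>, although both blow up as \<open>h\<close> tends to \<open>1/2\<close>.\<close>
lemma kernel_integral_bounds:
  fixes h s t :: real
  assumes h: "1/2 < h" "h < 1" and st: "0 < s" "s \<le> t"
  defines "G \<equiv> LINT u:{s..t}|lborel. (u - s) powr (h - 3/2) * u powr (h - 1/2)"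
  shows "(t - s) powr (2 * h - 1) / (2 * h - 1) \<le> G" "G \<le> t powr (2 * h - 1) / (h - 1/2)"
proof -
  have maj: "set_integrable lborel {s..t} (\<lambda>u. t powr (h - 1/2) * (u - s) powr (h - 3/2))"
    using integral_shifted_powr(1)[of "h - 3/2" s t] h st by (intro set_integrable_mult_right) auto
  have G: "set_integrable lborel {s..t} (\<lambda>u. (u - s) powr (h - 3/2) * u powr (h - 1/2))"
    using maj
  proof (rule set_integrable_bound)
    show "set_borel_measurable lborel {s..t} (\<lambda>u. (u - s) powr (h - 3/2) * u powr (h - 1/2))"
      unfolding set_borel_measurable_def by measurable
    show "AE u in lborel. u \<in> {s..t} \<longrightarrow> norm ((u - s) powr (h - 3/2) * u powr (h - 1/2))
        \<le> norm (t powr (h - 1/2) * (u - s) powr (h - 3/2))"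
      using h st by (auto intro!: AE_I2 mult_right_mono powr_mono2 simp: abs_mult mult.commute)
  qed
  have "G \<le> (LINT u:{s..t}|lborel. t powr (h - 1/2) * (u - s) powr (h - 3/2))"
    unfolding G_def using h st
    by (intro set_integral_mono G maj) (auto simp: mult.commute intro!: mult_right_mono powr_mono2)
  also have "\<dots> = t powr (h - 1/2) * ((t - s) powr (h - 3/2 + 1) / (h - 3/2 + 1))"
    using h st by (simp add: integral_shifted_powr)
  also have "\<dots> \<le> t powr (h - 1/2) * (t powr (h - 1/2) / (h - 1/2))"
    using h st by (intro mult_left_mono) (auto intro!: divide_right_mono powr_mono2)
  also have "\<dots> = t powr (2 * h - 1) / (h - 1/2)"
    using powr_add[of t "h - 1/2" "h - 1/2"] by (simp add: algebra_simps)
  finally show "G \<le> t powr (2 * h - 1) / (h - 1/2)" .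
  have "(t - s) powr (2 * h - 1) / (2 * h - 1) = (LINT u:{s..t}|lborel. (u - s) powr (2 * h - 2))"
    using h st by (simp add: integral_shifted_powr)
  also have "\<dots> \<le> G"
    unfolding G_def
  proof (intro set_integral_mono G)
    show "set_integrable lborel {s..t} (\<lambda>u. (u - s) powr (2 * h - 2))"
      using integral_shifted_powr(1)[of "2 * h - 2" s t] h st by simp
    fix u assume u: "u \<in> {s..t}"
    have "(u - s) powr (2 * h - 2) = (u - s) powr (h - 3/2) * (u - s) powr (h - 1/2)"
      by (simp flip: powr_add)
    also have "\<dots> \<le> (u - s) powr (h - 3/2) * u powr (h - 1/2)"
      using u h st by (intro mult_left_mono powr_mono2) auto
    finally show "(u - s) powr (2 * h - 2) \<le> (u - s) powr (h - 3/2) * u powr (h - 1/2)" .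
  qed
  finally show "(t - s) powr (2 * h - 1) / (2 * h - 1) \<le> G" .
qed

lemma c_hurst_pos:
  assumes "1/2 < h" "h < 1"
  shows "0 < c_hurst h"
  using assms unfolding c_hurst_def by (auto intro!: divide_pos_pos mult_pos_pos simp: Beta_def)

text \<open>The constant in the power law satisfied by the kernel near \<open>0\<close>, normalised so that it
  is the lower constant; the upper one is four times as large.\<close>
definition kernel_amplitude :: "real \<Rightarrow> real \<Rightarrow> real" where
  "kernel_amplitude h t = c_hurst h * t powr (2 * h - 1) / (4 * (h - 1/2))"

lemma kernel_amplitude_pos:
  assumes "1/2 < h" "h < 1" "0 < t"
  shows "0 < kernel_amplitude h t"
  using assms c_hurst_pos unfolding kernel_amplitude_def by auto

lemma K_kernel_nonneg:
  assumes "1/2 < H t" "H t < 1"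
  shows "0 \<le> K_kernel H t s"
  using c_hurst_pos[OF assms] unfolding K_kernel_def set_lebesgue_integral_def
  by (auto intro!: mult_nonneg_nonneg Bochner_Integration.integral_nonneg)

lemma K_kernel_upper:
  assumes h: "1/2 < H t" "H t < 1" and t: "0 \<le> t"
  shows "K_kernel H t s \<le> 4 * kernel_amplitude (H t) t * s powr (1/2 - H t) * indicator {0..t} s"
proof (cases "0 < s \<and> s \<le> t")
  case True
  have "c_hurst (H t) * s powr (1/2 - H t)
        * (LINT u:{s..t}|lborel. (u - s) powr (H t - 3/2) * u powr (H t - 1/2))
      \<le> c_hurst (H t) * s powr (1/2 - H t) * (t powr (2 * H t - 1) / (H t - 1/2))"
    using kernel_integral_bounds(2)[OF h, of s t] c_hurst_pos[OF h] True
    by (intro mult_left_mono) auto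
  then have "K_kernel H t s \<le> c_hurst (H t) * s powr (1/2 - H t) * (t powr (2 * H t - 1) / (H t - 1/2))"
    using True by (simp add: K_kernel_def)
  moreover have "4 * kernel_amplitude (H t) t = c_hurst (H t) * (t powr (2 * H t - 1) / (H t - 1/2))"
    using h by (simp add: kernel_amplitude_def divide_simps)
  ultimately show ?thesis
    using True by (simp add: mult_ac)
next
  case False
  then show ?thesis
    by (auto simp: K_kernel_def indicator_def)
qed

lemma K_kernel_lower:
  assumes h: "1/2 < H t" "H t < 1" and s: "0 < s" "s \<le> t / 2"
  shows "kernel_amplitude (H t) t * s powr (1/2 - H t) \<le> K_kernel H t s"
proof -
  \<comment> \<open>Half of \<open>t\<close> remains above \<open>s\<close>; this costs a factor of at most two since the exponent is at most one.\<close>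
  have "1/2 \<le> (1/2) powr (2 * H t - 1)"
    using powr_mono'[of "2 * H t - 1" 1 "1/2::real"] h by simp
  then have "t powr (2 * H t - 1) / 2 \<le> (t * (1 / 2)) powr (2 * H t - 1)"
    using s by (subst powr_mult) (auto simp: field_simps)
  also have "\<dots> \<le> (t - s) powr (2 * H t - 1)"
    using s h by (intro powr_mono2) auto
  finally have "t powr (2 * H t - 1) / 2 / (2 * H t - 1) \<le> (t - s) powr (2 * H t - 1) / (2 * H t - 1)"
    using h by (intro divide_right_mono) auto
  also have "\<dots> \<le> (LINT u:{s..t}|lborel. (u - s) powr (H t - 3/2) * u powr (H t - 1/2))"
    using kernel_integral_bounds(1)[OF h, of s t] s by simp
  finally have "c_hurst (H t) * s powr (1/2 - H t) * (t powr (2 * H t - 1) / 2 / (2 * H t - 1))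
      \<le> c_hurst (H t) * s powr (1/2 - H t)
        * (LINT u:{s..t}|lborel. (u - s) powr (H t - 3/2) * u powr (H t - 1/2))"
    using c_hurst_pos[OF h] s by (intro mult_left_mono) auto
  also have "\<dots> = K_kernel H t s"
    using s by (simp add: K_kernel_def)
  finally have "c_hurst (H t) * s powr (1/2 - H t) * (t powr (2 * H t - 1) / 2 / (2 * H t - 1))
      \<le> K_kernel H t s" .
  moreover have "t powr (2 * H t - 1) / 2 / (2 * H t - 1) = t powr (2 * H t - 1) / (4 * (H t - 1/2))"
    using h by (simp add: field_simps)
  ultimately show ?thesis
    by (simp add: kernel_amplitude_def mult_ac)
qed

lemma K_kernel_measurable [measurable]: "K_kernel H t \<in> borel_measurable borel"
proof -
  have [measurable]: "(\<lambda>s. LINT u|lborel. indicator {s..t} u *\<^sub>R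
      ((u - s) powr (H t - 3/2) * u powr (H t - 1/2))) \<in> borel_measurable borel"
    unfolding indicator_def atLeastAtMost_iff by measurable
  show ?thesis
    unfolding K_kernel_def set_lebesgue_integral_def by measurable
qed

text \<open>The square is dominated by a multiple of \<open>s powr (1 - 2 * H t)\<close> on \<open>[0, t]\<close>,
  and the exponent exceeds \<open>-1\<close> because \<open>H t < 1\<close>.\<close>
lemma K_kernel_square_integrable:
  assumes h: "1/2 < H t" "H t < 1" and t: "0 \<le> t"
  shows "integrable lborel (\<lambda>s. (K_kernel H t s)\<^sup>2)"
proof -
  let ?b = "4 * kernel_amplitude (H t) t"
  have "set_integrable lborel {0..t} (\<lambda>s. ?b\<^sup>2 * (s - 0) powr (1 - 2 * H t))"
    using h t by (intro set_integrable_mult_right integral_shifted_powr) auto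
  then have "integrable lborel (\<lambda>s. indicator {0..t} s * (?b\<^sup>2 * s powr (1 - 2 * H t)))"
    by (simp add: set_integrable_def)
  then show ?thesis
  proof (rule Bochner_Integration.integrable_bound)
    show "AE s in lborel. norm ((K_kernel H t s)\<^sup>2)
        \<le> norm (indicator {0..t} s * (?b\<^sup>2 * s powr (1 - 2 * H t)))"
    proof (rule AE_I2)
      fix s
      have "(K_kernel H t s)\<^sup>2 \<le> (?b * s powr (1/2 - H t) * indicator {0..t} s)\<^sup>2"
        using K_kernel_nonneg[of H t, OF h] K_kernel_upper[of H t, OF h t] by (intro power_mono) auto
      also have "\<dots> = indicator {0..t} s * (?b\<^sup>2 * s powr (1 - 2 * H t))"
        using powr_add[of s "1/2 - H t" "1/2 - H t"]
        by (auto simp: indicator_def power2_eq_square algebra_simps)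
      finally show "norm ((K_kernel H t s)\<^sup>2)
          \<le> norm (indicator {0..t} s * (?b\<^sup>2 * s powr (1 - 2 * H t)))"
        by simp
    qed
  qed simp
qed

text \<open>The product of two kernels vanishes outside \<open>[0, min s t]\<close>, so that the covariance is a
  Gram matrix in \<open>L\<^sup>2\<close> of the whole line.\<close>
lemma R_cov_eq_inner_product: "R_cov H t s = (\<integral>u. K_kernel H t u * K_kernel H s u \<partial>lborel)"
  unfolding R_cov_def set_lebesgue_integral_def
  by (intro Bochner_Integration.integral_cong) (auto simp: K_kernel_def indicator_def)

section \<open>Square-integrable functions\<close>

lemma integrable_prod_of_squares:
  fixes f g :: "'a \<Rightarrow> real"
  assumes [measurable]: "f \<in> borel_measurable M" "g \<in> borel_measurable M"
    and "integrable M (\<lambda>x. (f x)\<^sup>2)" "integrable M (\<lambda>x. (g x)\<^sup>2)"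
  shows "integrable M (\<lambda>x. f x * g x)"
proof (rule Bochner_Integration.integrable_bound)
  show "integrable M (\<lambda>x. (f x)\<^sup>2 + (g x)\<^sup>2)"
    using assms by simp
  have "\<bar>a * b\<bar> \<le> a\<^sup>2 + b\<^sup>2" for a b :: real
  proof -
    have "2 * (\<bar>a\<bar> * \<bar>b\<bar>) \<le> a\<^sup>2 + b\<^sup>2"
      using sum_squares_bound[of "\<bar>a\<bar>" "\<bar>b\<bar>"] by (simp add: mult.assoc)
    moreover have "0 \<le> \<bar>a\<bar> * \<bar>b\<bar>"
      by simp
    ultimately show ?thesis
      by (simp only: abs_mult)
  qed
  then show "AE x in M. norm (f x * g x) \<le> norm ((f x)\<^sup>2 + (g x)\<^sup>2)"
    by (intro AE_I2) simp
qed measurable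

lemma integral_diff_square:
  fixes f g :: "'a \<Rightarrow> real"
  assumes [measurable]: "f \<in> borel_measurable M" "g \<in> borel_measurable M"
    and sq: "integrable M (\<lambda>x. (f x)\<^sup>2)" "integrable M (\<lambda>x. (g x)\<^sup>2)"
  shows "integrable M (\<lambda>x. (f x - g x)\<^sup>2)"
    and "(\<integral>x. (f x - g x)\<^sup>2 \<partial>M) = (\<integral>x. f x * f x \<partial>M) - 2 * (\<integral>x. f x * g x \<partial>M) + (\<integral>x. g x * g x \<partial>M)"
proof -
  have fg: "integrable M (\<lambda>x. f x * g x)"
    by (rule integrable_prod_of_squares[OF assms])
  have ff: "integrable M (\<lambda>x. f x * f x)" "integrable M (\<lambda>x. g x * g x)"
    using sq by (auto simp: power2_eq_square)
  have eq: "(\<lambda>x. (f x - g x)\<^sup>2) = (\<lambda>x. f x * f x - 2 * (f x * g x) + g x * g x)"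
    by (auto simp: power2_eq_square algebra_simps)
  show "integrable M (\<lambda>x. (f x - g x)\<^sup>2)"
    unfolding eq using fg ff by auto
  show "(\<integral>x. (f x - g x)\<^sup>2 \<partial>M) = (\<integral>x. f x * f x \<partial>M) - 2 * (\<integral>x. f x * g x \<partial>M) + (\<integral>x. g x * g x \<partial>M)"
    unfolding eq using fg ff by simp
qed

section \<open>Kernels with different Hurst indices\<close>

text \<open>A power function with exponent at least \<open>\<epsilon>\<close> in absolute value varies by a large
  factor between \<open>(0, r]\<close> and \<open>[\<tau>/2, \<infinity>)\<close> once \<open>r\<close> is small
  enough, and the choice of \<open>r\<close> depends on \<open>\<epsilon>\<close> and \<open>\<tau>\<close> only. The
  factor \<open>64\<close> leaves room for the total loss of \<open>48\<close> in the comparison of kernels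
  below.\<close>
lemma powr_windows:
  fixes \<epsilon> \<tau> :: real
  assumes "0 < \<epsilon>" "0 < \<tau>"
  obtains r where "0 < r" "r \<le> \<tau>"
    and "\<And>d s1 s2. \<lbrakk>\<epsilon> \<le> \<bar>d\<bar>; 0 < s1; s1 \<le> r; \<tau> / 2 \<le> s2\<rbrakk>
      \<Longrightarrow> 64 * s1 powr d \<le> s2 powr d \<or> 64 * s2 powr d \<le> s1 powr d"
proof
  define r where "r = \<tau> / 2 * 64 powr (- 1 / \<epsilon>)"
  have le1: "(64::real) powr (- 1 / \<epsilon>) \<le> 1"
    using powr_mono[of "- 1 / \<epsilon>" 0 64] assms by simp
  show "0 < r" using assms by (simp add: r_def)
  have r_le: "r \<le> \<tau> / 2" using mult_left_le[OF le1, of "\<tau> / 2"] assms by (simp add: r_def)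
  then show "r \<le> \<tau>" using assms by simp
  fix d s1 s2 :: real
  assume d: "\<epsilon> \<le> \<bar>d\<bar>" and s: "0 < s1" "s1 \<le> r" "\<tau> / 2 \<le> s2"
  have "64 powr (1 / \<epsilon>) = \<tau> / 2 / r"
    using assms by (simp add: r_def powr_minus divide_simps)
  also have "\<dots> \<le> s2 / s1"
    using s assms by (intro frac_le) auto
  finally have q: "64 powr (1 / \<epsilon>) \<le> s2 / s1" .
  have "(64::real) = (64 powr (1 / \<epsilon>)) powr \<epsilon>"
    using assms by (simp add: powr_powr)
  also have "\<dots> \<le> (s2 / s1) powr \<epsilon>"
    using q assms by (intro powr_mono2) auto
  also have "\<dots> \<le> (s2 / s1) powr \<bar>d\<bar>"
    using d s r_le by (intro powr_mono) (auto simp: field_simps)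
  finally have "64 * s1 powr \<bar>d\<bar> \<le> s2 powr \<bar>d\<bar>"
    using s assms by (simp add: powr_divide field_simps)
  then show "64 * s1 powr d \<le> s2 powr d \<or> 64 * s2 powr d \<le> s1 powr d"
    using s assms by (cases "d \<ge> 0") (auto simp: powr_minus field_simps)
qed

text \<open>If the kernels differed by less than half of \<open>K_kernel H t0\<close> at some point \<open>s1\<close> near
  \<open>0\<close> and also at some point \<open>s2\<close> of \<open>[\<tau>/2, \<tau>]\<close>, then
  \<open>s powr (H t0 - H t)\<close> would take comparable values at \<open>s1\<close> and \<open>s2\<close>, which
  \<open>powr_windows\<close> excludes. So on one of the two windows the kernels differ everywhere by at
  least half of \<open>K_kernel H t0\<close>. The latter is bounded away from \<open>0\<close> on both windows,
  by a bound that does not involve \<open>t\<close> or \<open>H t\<close>.\<close>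
lemma K_kernel_L2_separated:
  assumes H: "\<And>t. t \<ge> 0 \<Longrightarrow> H t \<in> {1/2<..<1}" and "0 < t0" "0 < \<epsilon>"
  obtains \<eta> where "0 < \<eta>"
    and "\<And>t. \<lbrakk>t0 / 2 \<le> t; \<epsilon> \<le> \<bar>H t - H t0\<bar>\<rbrakk>
      \<Longrightarrow> \<eta> \<le> (\<integral>s. (K_kernel H t s - K_kernel H t0 s)\<^sup>2 \<partial>lborel)"
proof -
  \<comment> \<open>Since \<open>t \<ge> t0 / 2\<close>, every \<open>s \<le> \<tau>\<close> satisfies \<open>s \<le> t / 2\<close>, as the lower bound of the kernel requires.\<close>
  define \<tau> where "\<tau> = t0 / 4"
  have "0 < \<tau>" using assms by (simp add: \<tau>_def)
  obtain r where r: "0 < r" "r \<le> \<tau>"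
    and win: "\<And>d s1 s2. \<lbrakk>\<epsilon> \<le> \<bar>d\<bar>; 0 < s1; s1 \<le> r; \<tau> / 2 \<le> s2\<rbrakk>
      \<Longrightarrow> 64 * s1 powr d \<le> s2 powr d \<or> 64 * s2 powr d \<le> s1 powr d"
    using powr_windows[OF \<open>0 < \<epsilon>\<close> \<open>0 < \<tau>\<close>] by blast
  have h0: "1/2 < H t0" "H t0 < 1" using H[of t0] \<open>0 < t0\<close> by auto
  define a where "a = kernel_amplitude (H t0) t0"
  have a: "0 < a" unfolding a_def by (intro kernel_amplitude_pos h0 \<open>0 < t0\<close>)
  define \<gamma> where "\<gamma> = a * \<tau> powr (1/2 - H t0)"
  have \<gamma>: "0 < \<gamma>" using a \<open>0 < \<tau>\<close> by (simp add: \<gamma>_def)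
  show thesis
  proof
    show "0 < (\<gamma> / 2)\<^sup>2 * (r / 2)" using \<gamma> r by simp
    fix t assume t: "t0 / 2 \<le> t" and diff: "\<epsilon> \<le> \<bar>H t - H t0\<bar>"
    then have "0 < t" using \<open>0 < t0\<close> by simp
    have h: "1/2 < H t" "H t < 1" using H[of t] \<open>0 < t\<close> by auto
    define b where "b = kernel_amplitude (H t) t"
    have b: "0 < b" unfolding b_def by (intro kernel_amplitude_pos h \<open>0 < t\<close>)
    let ?f = "K_kernel H t" and ?g = "K_kernel H t0"
    define close where "close s \<longleftrightarrow> \<bar>?f s - ?g s\<bar> < ?g s / 2" for s
    have g_ge: "\<gamma> \<le> ?g s" if "0 < s" "s \<le> \<tau>" for s
    proof -
      have "\<gamma> \<le> a * s powr (1/2 - H t0)"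
        unfolding \<gamma>_def using that a h0 by (intro mult_left_mono powr_mono2') auto
      also have "\<dots> \<le> ?g s"
        unfolding a_def using that h0 by (intro K_kernel_lower) (auto simp: \<tau>_def)
      finally show ?thesis .
    qed
    \<comment> \<open>Closeness confines \<open>s powr (H t0 - H t)\<close> to an interval whose endpoints have ratio \<open>48\<close>,
      irrespective of the unknown amplitude \<open>b\<close>.\<close>
    have close_imp: "a < 8 * b * s powr (H t0 - H t) \<and> b * s powr (H t0 - H t) < 6 * a"
      if "0 < s" "s \<le> \<tau>" "close s" for s
    proof -
      have sp: "0 < s powr (1/2 - H t0)" using that by simp
      have mult: "s powr (1/2 - H t) = s powr (H t0 - H t) * s powr (1/2 - H t0)"
        by (simp flip: powr_add)
      have f: "b * s powr (1/2 - H t) \<le> ?f s" "?f s \<le> 4 * b * s powr (1/2 - H t)"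
        using K_kernel_lower[of H t, OF h, of s] K_kernel_upper[of H t, OF h, of s] that t \<open>0 < t\<close>
        by (auto simp: b_def \<tau>_def)
      have g: "a * s powr (1/2 - H t0) \<le> ?g s" "?g s \<le> 4 * a * s powr (1/2 - H t0)"
        using K_kernel_lower[of H t0, OF h0, of s] K_kernel_upper[of H t0, OF h0, of s] that \<open>0 < t0\<close>
        by (auto simp: a_def \<tau>_def)
      have c: "?g s < 2 * ?f s" "2 * ?f s < 3 * ?g s"
        using \<open>close s\<close> unfolding close_def by linarith+
      have "a * s powr (1/2 - H t0) < (8 * b * s powr (H t0 - H t)) * s powr (1/2 - H t0)"
        using f g c unfolding mult by (simp add: mult.assoc)
      moreover have "(b * s powr (H t0 - H t)) * s powr (1/2 - H t0) < (6 * a) * s powr (1/2 - H t0)"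
        using f g c unfolding mult by (simp add: mult.assoc)
      ultimately show ?thesis
        using sp by (simp add: mult_less_cancel_right)
    qed
    have "\<not> (close s1 \<and> close s2)"
      if "0 < s1" "s1 \<le> r" "\<tau> / 2 \<le> s2" "s2 \<le> \<tau>" for s1 s2
    proof
      assume cl: "close s1 \<and> close s2"
      let ?x = "\<lambda>s. b * s powr (H t0 - H t)"
      have x: "a < 8 * ?x s1" "?x s1 < 6 * a" "a < 8 * ?x s2" "?x s2 < 6 * a"
        using close_imp[of s1] close_imp[of s2] that cl r \<open>0 < \<tau>\<close> by auto
      have "64 * s1 powr (H t0 - H t) \<le> s2 powr (H t0 - H t)
          \<or> 64 * s2 powr (H t0 - H t) \<le> s1 powr (H t0 - H t)"
        using diff that by (intro win) auto
      then have "64 * ?x s1 \<le> ?x s2 \<or> 64 * ?x s2 \<le> ?x s1"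
        using b by (auto simp: mult.left_commute[of _ b])
      then show False using x a by linarith
    qed
    then have "(\<forall>s\<in>{r/2..r}. \<not> close s) \<or> (\<forall>s\<in>{\<tau>/2..\<tau>}. \<not> close s)"
      using r by (meson atLeastAtMost_iff half_gt_zero order_less_le_trans)
    then have "\<exists>l u. 0 < l \<and> u \<le> \<tau> \<and> r / 2 \<le> u - l \<and> (\<forall>s\<in>{l..u}. \<not> close s)"
    proof
      assume "\<forall>s\<in>{r/2..r}. \<not> close s"
      then show ?thesis
        using r by (intro exI[of _ "r / 2"] exI[of _ r]) auto
    next
      assume "\<forall>s\<in>{\<tau>/2..\<tau>}. \<not> close s"
      then show ?thesis
        using r \<open>0 < \<tau>\<close> by (intro exI[of _ "\<tau> / 2"] exI[of _ \<tau>]) auto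
    qed
    then obtain l u where lu: "0 < l" "u \<le> \<tau>" "r / 2 \<le> u - l" "\<forall>s\<in>{l..u}. \<not> close s"
      by blast
    have int: "integrable lborel (\<lambda>s. (?f s - ?g s)\<^sup>2)"
      using h h0 \<open>0 < t\<close> \<open>0 < t0\<close> by (intro integral_diff_square K_kernel_square_integrable) auto
    have "(\<gamma> / 2)\<^sup>2 * (r / 2) \<le> (\<gamma> / 2)\<^sup>2 * (u - l)"
      using lu by (intro mult_left_mono) auto
    also have "\<dots> = (\<integral>s. (\<gamma> / 2)\<^sup>2 * indicator {l..u} s \<partial>lborel)"
      using lu r by simp
    also have "\<dots> \<le> (\<integral>s. (?f s - ?g s)\<^sup>2 \<partial>lborel)"
    proof (rule integral_mono)
      show "integrable lborel (\<lambda>s. (\<gamma> / 2)\<^sup>2 * indicator {l..u} s)"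
        by (intro integrable_mult_right integrable_real_indicator) (auto simp: emeasure_lborel_Icc_eq)
      fix s
      show "(\<gamma> / 2)\<^sup>2 * indicator {l..u} s \<le> (?f s - ?g s)\<^sup>2"
      proof (cases "s \<in> {l..u}")
        case True
        then have "\<gamma> \<le> ?g s" "\<not> close s" using g_ge[of s] lu by auto
        then have "\<gamma> / 2 \<le> \<bar>?f s - ?g s\<bar>" unfolding close_def by linarith
        then have "(\<gamma> / 2)\<^sup>2 \<le> \<bar>?f s - ?g s\<bar>\<^sup>2" using \<gamma> by (intro power_mono) auto
        then show ?thesis using True by simp
      qed simp
    qed (rule int)
    finally show "(\<gamma> / 2)\<^sup>2 * (r / 2) \<le> (\<integral>s. (?f s - ?g s)\<^sup>2 \<partial>lborel)" .
  qed
qed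

section \<open>Small-ball estimates for normal variables\<close>

lemma AE_eq_of_distr_Dirac:
  assumes "Y \<in> borel_measurable M" and law: "distr M borel Y = normal_law m 0"
  shows "AE \<omega> in M. Y \<omega> = (m :: real)"
proof -
  have "AE y in distr M borel Y. y = m"
    unfolding law normal_law_def by (simp add: AE_return)
  then show ?thesis
    using assms(1) by (subst (asm) AE_distr_iff) auto
qed

lemma (in prob_space) normal_law_square_integrable:
  assumes Y [measurable]: "Y \<in> borel_measurable M" and "0 \<le> \<sigma>"
    and law: "distr M borel Y = normal_law m \<sigma>"
  shows "integrable M Y" "integrable M (\<lambda>\<omega>. (Y \<omega>)\<^sup>2)"
proof -
  have "integrable M Y \<and> integrable M (\<lambda>\<omega>. (Y \<omega>)\<^sup>2)"
  proof (cases "\<sigma> = 0")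
    case True
    have ae: "AE \<omega> in M. Y \<omega> = m"
      using law True by (intro AE_eq_of_distr_Dirac) auto
    have "integrable M Y \<longleftrightarrow> integrable M (\<lambda>_. m)"
      using ae by (intro integrable_cong_AE) auto
    moreover have "integrable M (\<lambda>\<omega>. (Y \<omega>)\<^sup>2) \<longleftrightarrow> integrable M (\<lambda>_. m\<^sup>2)"
      using ae by (intro integrable_cong_AE) auto
    ultimately show ?thesis
      by simp
  next
    case False
    then have pos: "0 < \<sigma>"
      using assms by simp
    have "distr M lborel Y = distr M borel Y"
      by (intro distr_cong) auto
    then have D: "distributed M lborel Y (normal_density m \<sigma>)"
      using False by (simp add: distributed_def law normal_law_def)
    have 1: "integrable lborel (\<lambda>x. normal_density m \<sigma> x * x)"
      by (rule integrable_normal_moment_nz_1[OF pos])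
    have "integrable lborel (\<lambda>x. normal_density m \<sigma> x * (x - m)^2
        + 2 * m * (normal_density m \<sigma> x * x) - m\<^sup>2 * normal_density m \<sigma> x)"
      using 1 integrable_normal_moment[OF pos, of m 2] integrable_normal_density[OF pos, of m]
      by (intro Bochner_Integration.integrable_add Bochner_Integration.integrable_diff
          integrable_mult_right) auto
    also have "(\<lambda>x. normal_density m \<sigma> x * (x - m)^2
        + 2 * m * (normal_density m \<sigma> x * x) - m\<^sup>2 * normal_density m \<sigma> x)
        = (\<lambda>x. normal_density m \<sigma> x * x\<^sup>2)"
      by (auto simp: power2_eq_square algebra_simps)
    finally have 2: "integrable lborel (\<lambda>x. normal_density m \<sigma> x * x\<^sup>2)" .
    show ?thesis
      using distributed_integrable[OF D, of "\<lambda>x. x"] distributed_integrable[OF D, of "\<lambda>x. x\<^sup>2"] 1 2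
      by simp
  qed
  then show "integrable M Y" "integrable M (\<lambda>\<omega>. (Y \<omega>)\<^sup>2)" by auto
qed

text \<open>A normal density with variance at least \<open>v\<close> is bounded by its maximum, which is at most
  \<open>1 / sqrt (2 * pi * v)\<close>. The lower bound on the second moment excludes the Dirac case of
  \<open>normal_law\<close>.\<close>
lemma (in prob_space) normal_small_ball:
  assumes Y [measurable]: "Y \<in> borel_measurable M" and "0 \<le> \<sigma>"
    and law: "distr M borel Y = normal_law m \<sigma>"
    and mean: "expectation Y = 0" and var: "v \<le> expectation (\<lambda>\<omega>. (Y \<omega>)\<^sup>2)" and "0 < v" "0 \<le> d"
  shows "prob {\<omega> \<in> space M. \<bar>Y \<omega>\<bar> \<le> d} \<le> 2 * d / sqrt (2 * pi * v)"
proof -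
  have "\<sigma> \<noteq> 0"
  proof
    assume True: "\<sigma> = 0"
    have ae: "AE \<omega> in M. Y \<omega> = m"
      using law True by (intro AE_eq_of_distr_Dirac) auto
    have "expectation Y = expectation (\<lambda>_. m)"
      using ae by (intro integral_cong_AE) auto
    then have "m = 0"
      using mean by (simp add: prob_space)
    have "expectation (\<lambda>\<omega>. (Y \<omega>)\<^sup>2) = expectation (\<lambda>_. 0)"
      using ae \<open>m = 0\<close> by (intro integral_cong_AE) auto
    then show False
      using var \<open>0 < v\<close> by simp
  qed
  then have pos: "0 < \<sigma>"
    using assms by simp
  have "distr M lborel Y = distr M borel Y"
    by (intro distr_cong) auto
  then have D: "distributed M lborel Y (normal_density m \<sigma>)"
    using pos by (simp add: distributed_def law normal_law_def)
  have "variance Y = \<sigma>\<^sup>2"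
    by (rule normal_distributed_variance[OF pos D])
  then have v: "v \<le> \<sigma>\<^sup>2"
    using mean var by simp
  have bound: "normal_density m \<sigma> x \<le> 1 / sqrt (2 * pi * v)" for x
  proof -
    have "normal_density m \<sigma> x \<le> 1 / sqrt (2 * pi * \<sigma>\<^sup>2) * 1"
      unfolding normal_density_def by (intro mult_left_mono) auto
    also have "\<dots> \<le> 1 / sqrt (2 * pi * v)"
      using v \<open>0 < v\<close> pos by (auto intro!: divide_left_mono mult_pos_pos)
    finally show ?thesis .
  qed
  have "emeasure M (Y -` {-d..d} \<inter> space M) = emeasure (distr M lborel Y) {-d..d}"
    by (simp add: emeasure_distr)
  also have "\<dots> = (\<integral>\<^sup>+x. ennreal (normal_density m \<sigma> x) * indicator {-d..d} x \<partial>lborel)"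
    using D by (simp add: distributed_def emeasure_density)
  also have "\<dots> \<le> (\<integral>\<^sup>+x. ennreal (1 / sqrt (2 * pi * v)) * indicator {-d..d} x \<partial>lborel)"
    using bound by (intro nn_integral_mono mult_right_mono) (auto simp: ennreal_leI)
  also have "\<dots> = ennreal (1 / sqrt (2 * pi * v)) * ennreal (2 * d)"
    using \<open>0 \<le> d\<close> by (subst nn_integral_cmult_indicator) auto
  also have "\<dots> = ennreal (2 * d / sqrt (2 * pi * v))"
    using \<open>0 \<le> d\<close> \<open>0 < v\<close> by (subst ennreal_mult[symmetric]) auto
  finally have "prob (Y -` {-d..d} \<inter> space M) \<le> 2 * d / sqrt (2 * pi * v)"
    using \<open>0 \<le> d\<close> \<open>0 < v\<close> by (simp add: emeasure_eq_measure)
  also have "Y -` {-d..d} \<inter> space M = {\<omega> \<in> space M. \<bar>Y \<omega>\<bar> \<le> d}"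
    by auto
  finally show ?thesis .
qed

text \<open>For each \<open>d\<close>, convergence to \<open>0\<close> forces the sequence to stay in
  \<open>[-d, d]\<close> eventually. Staying there from index \<open>N\<close> on is at most as likely as
  \<open>\<bar>Y N\<bar> \<le> d\<close>, which has probability at most \<open>2 * d / sqrt (2 * pi * v)\<close>
  for every \<open>N\<close>; now let \<open>d\<close> tend to \<open>0\<close>.\<close>
lemma (in prob_space) AE_not_tendsto_0_of_variance_bounded_below:
  fixes Y :: "nat \<Rightarrow> 'a \<Rightarrow> real"
  assumes Y [measurable]: "\<And>n. Y n \<in> borel_measurable M"
    and law: "\<And>n. \<exists>m \<sigma>. 0 \<le> \<sigma> \<and> distr M borel (Y n) = normal_law m \<sigma>"
    and mean: "\<And>n. expectation (Y n) = 0"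
    and var: "\<And>n. v \<le> expectation (\<lambda>\<omega>. (Y n \<omega>)\<^sup>2)" and "0 < v"
  shows "AE \<omega> in M. \<not> (\<lambda>n. Y n \<omega>) \<longlonglongrightarrow> 0"
proof -
  define E where "E = {\<omega> \<in> space M. (\<lambda>n. Y n \<omega>) \<longlonglongrightarrow> 0}"
  define B where "B d N = {\<omega> \<in> space M. \<forall>n\<ge>N. \<bar>Y n \<omega>\<bar> \<le> d}" for d :: real and N :: nat
  have [measurable]: "E \<in> events" "B d N \<in> events" for d N
    unfolding E_def B_def by measurable
  have le: "prob E \<le> 2 * d / sqrt (2 * pi * v)" if "0 < d" for d
  proof -
    have sub: "E \<subseteq> (\<Union>N. B d N)"
    proof
      fix \<omega> assume \<omega>: "\<omega> \<in> E"
      then obtain N where "\<forall>n\<ge>N. norm (Y n \<omega> - 0) < d"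
        using LIMSEQ_D[of "\<lambda>n. Y n \<omega>" 0 d] \<open>0 < d\<close> unfolding E_def by blast
      then have "\<omega> \<in> B d N"
        using \<omega> by (auto simp: B_def E_def less_imp_le)
      then show "\<omega> \<in> (\<Union>N. B d N)" by auto
    qed
    have "incseq (B d)"
      by (auto simp: incseq_def B_def)
    then have "(\<lambda>N. prob (B d N)) \<longlonglongrightarrow> prob (\<Union>N. B d N)"
      by (intro finite_Lim_measure_incseq) auto
    moreover have "prob (B d N) \<le> 2 * d / sqrt (2 * pi * v)" for N
    proof -
      obtain m \<sigma> where *: "0 \<le> \<sigma>" "distr M borel (Y N) = normal_law m \<sigma>"
        using law by blast
      have "prob (B d N) \<le> prob {\<omega> \<in> space M. \<bar>Y N \<omega>\<bar> \<le> d}"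
        by (intro finite_measure_mono) (auto simp: B_def)
      also have "\<dots> \<le> 2 * d / sqrt (2 * pi * v)"
        using normal_small_ball[OF Y * mean var \<open>0 < v\<close>] \<open>0 < d\<close> by simp
      finally show ?thesis .
    qed
    ultimately have "prob (\<Union>N. B d N) \<le> 2 * d / sqrt (2 * pi * v)"
      by (intro LIMSEQ_le_const2) auto
    moreover have "prob E \<le> prob (\<Union>N. B d N)"
      using sub by (intro finite_measure_mono) auto
    ultimately show ?thesis by simp
  qed
  have "prob E \<le> 0"
  proof (rule field_le_epsilon)
    fix e :: real assume "0 < e"
    then show "prob E \<le> 0 + e"
      using le[of "e * sqrt (2 * pi * v) / 2"] \<open>0 < v\<close> by simp
  qed
  then have "prob E = 0"
    using measure_nonneg[of M E] by linarith
  then have "AE \<omega> in M. \<omega> \<notin> E"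
    by (simp add: prob_eq_0)
  then show ?thesis
    by (rule AE_mp) (auto simp: E_def)
qed

section \<open>Increments of the process and the discontinuity\<close>

lemma fBMvH_increment_law:
  assumes X: "fBMvH M H X" and st: "0 \<le> s" "0 \<le> t" "s \<noteq> t"
  shows "\<exists>m \<sigma>. 0 \<le> \<sigma> \<and> distr M borel (\<lambda>\<omega>. X t \<omega> - X s \<omega>) = normal_law m \<sigma>"
proof -
  have "\<exists>m \<sigma>. 0 \<le> \<sigma> \<and> distr M borel (\<lambda>\<omega>. \<Sum>u\<in>{t, s}. (if u = t then 1 else - 1) * X u \<omega>)
      = normal_law m \<sigma>"
    using X st unfolding fBMvH_def gaussian_process_def
    by (elim conjE allE[of _ "{t, s}"] allE[of _ "\<lambda>u. if u = t then 1 else - 1 :: real"]) auto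
  then show ?thesis
    using st by simp
qed

lemma (in prob_space) fBMvH_square_integrable:
  assumes X: "fBMvH M H X" and t: "0 \<le> t"
  shows "integrable M (X t)" "integrable M (\<lambda>\<omega>. (X t \<omega>)\<^sup>2)"
proof -
  have meas: "X t \<in> borel_measurable M"
    using X t by (auto simp: fBMvH_def gaussian_process_def)
  have "\<exists>m \<sigma>. 0 \<le> \<sigma> \<and> distr M borel (\<lambda>\<omega>. \<Sum>u\<in>{t}. 1 * X u \<omega>) = normal_law m \<sigma>"
    using X t unfolding fBMvH_def gaussian_process_def
    by (elim conjE allE[of _ "{t}"] allE[of _ "\<lambda>_. 1 :: real"]) auto
  then obtain m \<sigma> where "0 \<le> \<sigma>" "distr M borel (X t) = normal_law m \<sigma>"
    by auto
  then show "integrable M (X t)" "integrable M (\<lambda>\<omega>. (X t \<omega>)\<^sup>2)"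
    using normal_law_square_integrable[OF meas] by auto
qed

text \<open>Both sides expand by the same bilinear formula, the left one in \<open>L\<^sup>2(M)\<close> and the right
  one in \<open>L\<^sup>2\<close> of the line, and the mixed terms agree by the definition of \<open>R_cov\<close>.\<close>
lemma (in prob_space) fBMvH_increment_variance:
  assumes H: "\<And>t. t \<ge> 0 \<Longrightarrow> H t \<in> {1/2<..<1}"
    and X: "fBMvH M H X" and st: "0 \<le> s" "0 \<le> t"
  shows "expectation (\<lambda>\<omega>. (X t \<omega> - X s \<omega>)\<^sup>2)
    = (\<integral>u. (K_kernel H t u - K_kernel H s u)\<^sup>2 \<partial>lborel)"
proof -
  have meas: "X u \<in> borel_measurable M" if "0 \<le> u" for u
    using X that by (auto simp: fBMvH_def gaussian_process_def)
  have cov: "expectation (\<lambda>\<omega>. X u \<omega> * X v \<omega>) = (\<integral>x. K_kernel H u x * K_kernel H v x \<partial>lborel)"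
    if "0 \<le> u" "0 \<le> v" for u v
  proof -
    have "expectation (X u) = 0" "expectation (X v) = 0" "covariance M (X u) (X v) = R_cov H u v"
      using X that by (auto simp: fBMvH_def)
    then show ?thesis
      by (simp add: covariance_def R_cov_eq_inner_product)
  qed
  have "integrable lborel (\<lambda>u. (K_kernel H v u)\<^sup>2)" if "0 \<le> v" for v
    using H[OF that] that by (intro K_kernel_square_integrable) auto
  then show ?thesis
    using st by (simp add: integral_diff_square(2) meas fBMvH_square_integrable[OF X] cov)
qed

text \<open>The indices \<open>t n\<close> are kept above \<open>t0 / 2\<close> so that the separation of the kernels
  applies with the same \<open>\<eta>\<close> for all of them.\<close>
lemma (in prob_space) fBMvH_AE_discontinuous_at:
  assumes H: "\<And>t. t \<ge> 0 \<Longrightarrow> H t \<in> {1/2<..<1}"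
    and X: "fBMvH M H X" and "0 < t0" and disc: "discontinuous_at H t0"
  shows "AE \<omega> in M. discontinuous_at (\<lambda>t. X t \<omega>) t0"
proof -
  obtain \<epsilon> where "0 < \<epsilon>"
    and far: "\<forall>\<delta>>0. \<exists>t\<in>{0..}. dist t t0 < \<delta> \<and> \<not> dist (H t) (H t0) < \<epsilon>"
    using disc unfolding discontinuous_at_def continuous_within_eps_delta by blast
  have "\<forall>n. \<exists>t. 0 \<le> t \<and> \<bar>t - t0\<bar> < min (t0 / 2) (1 / Suc n) \<and> \<epsilon> \<le> \<bar>H t - H t0\<bar>"
  proof
    fix n
    show "\<exists>t. 0 \<le> t \<and> \<bar>t - t0\<bar> < min (t0 / 2) (1 / Suc n) \<and> \<epsilon> \<le> \<bar>H t - H t0\<bar>"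
      using far[rule_format, of "min (t0 / 2) (1 / Suc n)"] \<open>0 < t0\<close>
      by (auto simp: dist_real_def not_less)
  qed
  then obtain t where t: "\<And>n. 0 \<le> t n" "\<And>n. \<bar>t n - t0\<bar> < min (t0 / 2) (1 / Suc n)"
      "\<And>n. \<epsilon> \<le> \<bar>H (t n) - H t0\<bar>"
    by metis
  have half: "t0 / 2 \<le> t n" for n
  proof -
    have "\<bar>t n - t0\<bar> < t0 / 2"
      using t(2)[of n] by simp
    then show ?thesis
      by linarith
  qed
  have ne: "t n \<noteq> t0" for n
    using t(3)[of n] \<open>0 < \<epsilon>\<close> by auto
  have "(\<lambda>n. t n - t0) \<longlonglongrightarrow> 0"
    using t(2) by (intro Lim_null_comparison[OF _ LIMSEQ_inverse_real_of_nat])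
      (auto intro!: always_eventually simp: inverse_eq_divide less_imp_le)
  then have lim: "t \<longlonglongrightarrow> t0"
    by (simp add: LIM_zero_iff)
  obtain \<eta> where "0 < \<eta>" and \<eta>: "\<And>t. \<lbrakk>t0 / 2 \<le> t; \<epsilon> \<le> \<bar>H t - H t0\<bar>\<rbrakk>
      \<Longrightarrow> \<eta> \<le> (\<integral>s. (K_kernel H t s - K_kernel H t0 s)\<^sup>2 \<partial>lborel)"
    using K_kernel_L2_separated[of H t0 \<epsilon>, OF H \<open>0 < t0\<close> \<open>0 < \<epsilon>\<close>] by metis
  have meas: "X u \<in> borel_measurable M" and mean: "expectation (X u) = 0" if "0 \<le> u" for u
    using X that by (auto simp: fBMvH_def gaussian_process_def)
  have "AE \<omega> in M. \<not> (\<lambda>n. X (t n) \<omega> - X t0 \<omega>) \<longlonglongrightarrow> 0"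
  proof (rule AE_not_tendsto_0_of_variance_bounded_below)
    fix n
    show "(\<lambda>\<omega>. X (t n) \<omega> - X t0 \<omega>) \<in> borel_measurable M"
      using t(1) \<open>0 < t0\<close> by (intro borel_measurable_diff meas) auto
    show "\<exists>m \<sigma>. 0 \<le> \<sigma> \<and> distr M borel (\<lambda>\<omega>. X (t n) \<omega> - X t0 \<omega>) = normal_law m \<sigma>"
      using t(1) ne[of n] \<open>0 < t0\<close> by (intro fBMvH_increment_law[OF X]) auto
    show "expectation (\<lambda>\<omega>. X (t n) \<omega> - X t0 \<omega>) = 0"
      using t(1)[of n] \<open>0 < t0\<close> by (simp add: fBMvH_square_integrable(1)[OF X] mean)
    show "\<eta> \<le> expectation (\<lambda>\<omega>. (X (t n) \<omega> - X t0 \<omega>)\<^sup>2)"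
      using fBMvH_increment_variance[of H X t0 "t n", OF H X] \<eta>[OF half t(3)[of n]]
        t(1)[of n] \<open>0 < t0\<close>
      by simp
  qed (rule \<open>0 < \<eta>\<close>)
  then show ?thesis
  proof (rule AE_mp, intro AE_I2 impI)
    fix \<omega> assume no_lim: "\<not> (\<lambda>n. X (t n) \<omega> - X t0 \<omega>) \<longlonglongrightarrow> 0"
    show "discontinuous_at (\<lambda>t. X t \<omega>) t0"
      unfolding discontinuous_at_def
    proof
      assume "continuous (at t0 within {0..}) (\<lambda>t. X t \<omega>)"
      then have "(\<lambda>n. X (t n) \<omega>) \<longlonglongrightarrow> X t0 \<omega>"
        using continuous_within_tendsto_compose'[OF _ _ lim] t(1) by auto
      then show False
        using no_lim by (simp add: LIM_zero_iff)
    qed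
  qed
qed

theorem proposition3p2p4:
  fixes M :: "'w measure" and H :: "real \<Rightarrow> real"
    and X :: "real \<Rightarrow> 'w \<Rightarrow> real" and t0 :: real
  assumes "prob_space M"
    and "H \<in> borel_measurable (restrict_space borel {0..})"
    and "\<And>t. t \<ge> 0 \<Longrightarrow> H t \<in> {1/2<..<1}"
    and "fBMvH M H X"
    and "separable_process M X"
    and "t0 \<ge> 0" and "t0 \<noteq> 0" and "discontinuous_at H t0"
  shows "(AE \<omega> in M. \<not> continuous_on {0..} (\<lambda>t. X t \<omega>))
    \<and> measure (completion M) {\<omega> \<in> space M. discontinuous_at (\<lambda>t. X t \<omega>) t0} > 0
    \<and> (AE \<omega> in M. discontinuous_at (\<lambda>t. X t \<omega>) t0 \<or>
          (\<exists>s :: nat \<Rightarrow> real.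
             (\<forall>n. s n \<ge> 0 \<and> s n \<noteq> t0 \<and> discontinuous_at (\<lambda>t. X t \<omega>) (s n))
             \<and> s \<longlonglongrightarrow> t0))"
proof -
  interpret prob_space M by fact
  have disc: "AE \<omega> in M. discontinuous_at (\<lambda>t. X t \<omega>) t0"
    using fBMvH_AE_discontinuous_at[of H X t0] assms by simp
  then have "AE \<omega> in M. \<not> continuous_on {0..} (\<lambda>t. X t \<omega>)"
    using \<open>t0 \<ge> 0\<close>
    by (auto elim!: eventually_mono simp: discontinuous_at_def continuous_on_eq_continuous_within)
  moreover have "measure (completion M) {\<omega> \<in> space M. discontinuous_at (\<lambda>t. X t \<omega>) t0} > 0"
  proof -
    interpret C: prob_space "completion M"
      by (rule prob_space_completion)
    let ?D = "{\<omega> \<in> space M. discontinuous_at (\<lambda>t. X t \<omega>) t0}"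
    \<comment> \<open>The set contains an almost sure event, so completeness makes it measurable and of measure one.\<close>
    obtain N where N: "{\<omega> \<in> space M. \<not> discontinuous_at (\<lambda>t. X t \<omega>) t0} \<subseteq> N" "N \<in> null_sets M"
      using AE_E[OF disc] by (metis null_setsI)
    have "space M - ?D \<in> null_sets (completion M)"
      unfolding null_sets_completion_iff2 using N by (intro bexI[of _ N]) auto
    then have "space M - (space M - ?D) \<in> sets (completion M)"
      by (metis null_setsD2 sets.compl_sets space_completion)
    also have "space M - (space M - ?D) = ?D" by auto
    finally have "?D \<in> C.events" .
    moreover have "AE \<omega> in completion M. discontinuous_at (\<lambda>t. X t \<omega>) t0"
      using disc by (rule AE_completion)
    ultimately have "C.prob ?D = 1"
      by (intro C.prob_eq_1[THEN iffD2]) auto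
    then show ?thesis by simp
  qed
  moreover have "AE \<omega> in M. discontinuous_at (\<lambda>t. X t \<omega>) t0 \<or>
      (\<exists>s :: nat \<Rightarrow> real.
        (\<forall>n. s n \<ge> 0 \<and> s n \<noteq> t0 \<and> discontinuous_at (\<lambda>t. X t \<omega>) (s n)) \<and> s \<longlonglongrightarrow> t0)"
    using disc by (rule AE_mp) (intro AE_I2 impI disjI1)
  ultimately show ?thesis
    by blast
qed

end
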